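(* Let $n\ge 2$, let $B\subset\mathbb{Z}^n$ be an $n$-box, and let $f:\partial B\to\mathbb{Z}^{n-1}$ be $(c_n,c_{n-1})$-continuous. Then there is some point $x\in\partial B$ such that $f(x)$ and $f(-x)$ are equal or $c_{n-1}$-adjacent.
   Context: For integers $1\le k\le N$, two distinct points of $\mathbb{Z}^N$ are $c_k$-adjacent if their coordinates differ by at most 1 in at most $k$ positions and are equal in all other positions. Subsets of $\mathbb{Z}^N$ carry the restricted relation. A function $f$ from a set with adjacency $\kappa$ to a set with adjacency $\lambda$ is $(\kappa,\lambda)$-continuous if whenever $a,b$ are $\kappa$-adjacent, $f(a)$ and $f(b)$ are $\lambda$-adjacent or equal. An $n$-box is a set $B=\prod_{i=1}^n\{a_i,a_i+1,\dots,b_i\}\subset\mathbb{Z}^n$ with $a_i,b_i\in\mathbb{Z}$ and $a_i<b_i$ for each $i$. Its boundary is $\partial B=\bigcup_{i=1}^n(\{x\in B:x_i=a_i\}\cup\{x\in B:x_i=b_i\})$. For $x\in B$, $-x$ denotes the antipodal point $(a_1+b_1-x_1,\dots,a_n+b_n-x_n)$ (not the additive inverse); this map preserves $\partial B$. *)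

theory Defs
  imports Main "HOL-Library.FuncSet"
begin

text \<open>Points of \<open>\<int>\<^sup>N\<close> are integer functions on the index set \<open>{1..N}\<close>, taking the
  value \<^const>\<open>undefined\<close> outside it, so that two points are equal iff all their
  coordinates agree.\<close>

type_synonym point = "nat \<Rightarrow> int"

definition int_lattice :: "nat \<Rightarrow> point set" where
  "int_lattice N = {1..N} \<rightarrow>\<^sub>E UNIV"

text \<open>\<open>c_adj N k\<close> is \<open>c\<^sub>k\<close>-adjacency on \<open>\<int>\<^sup>N\<close>, meant for \<open>1 \<le> k \<le> N\<close>; \<open>S\<close> collects the at
  most \<open>k\<close> positions in which the coordinates may differ.\<close>

definition c_adj :: "nat \<Rightarrow> nat \<Rightarrow> point \<Rightarrow> point \<Rightarrow> bool" where
  "c_adj N k x y \<longleftrightarrow>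
     x \<in> int_lattice N \<and> y \<in> int_lattice N \<and> x \<noteq> y \<and>
     (\<exists>S \<subseteq> {1..N}. card S \<le> k \<and> (\<forall>i\<in>S. \<bar>x i - y i\<bar> \<le> 1) \<and> (\<forall>i\<in>{1..N} - S. x i = y i))"

definition dig_continuous ::
  "'a set \<Rightarrow> ('a \<Rightarrow> 'a \<Rightarrow> bool) \<Rightarrow> 'b set \<Rightarrow> ('b \<Rightarrow> 'b \<Rightarrow> bool) \<Rightarrow> ('a \<Rightarrow> 'b) \<Rightarrow> bool" where
  "dig_continuous X \<kappa> Y \<mu> f \<longleftrightarrow>
     f \<in> X \<rightarrow> Y \<and> (\<forall>x\<in>X. \<forall>y\<in>X. \<kappa> x y \<longrightarrow> \<mu> (f x) (f y) \<or> f x = f y)"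

text \<open>A box is given by its corners \<open>a\<close> and \<open>b\<close>, of which only the coordinates in \<open>{1..n}\<close>
  matter; the requirement \<open>a i < b i\<close> is imposed where boxes are used.\<close>

definition int_box :: "nat \<Rightarrow> (nat \<Rightarrow> int) \<Rightarrow> (nat \<Rightarrow> int) \<Rightarrow> point set" where
  "int_box n a b = (\<Pi>\<^sub>E i\<in>{1..n}. {a i..b i})"

definition box_boundary :: "nat \<Rightarrow> (nat \<Rightarrow> int) \<Rightarrow> (nat \<Rightarrow> int) \<Rightarrow> point set" where
  "box_boundary n a b =
     (\<Union>i\<in>{1..n}. {x \<in> int_box n a b. x i = a i} \<union> {x \<in> int_box n a b. x i = b i})"

definition antipode :: "nat \<Rightarrow> (nat \<Rightarrow> int) \<Rightarrow> (nat \<Rightarrow> int) \<Rightarrow> point \<Rightarrow> point" where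
  "antipode n a b x = (\<lambda>i\<in>{1..n}. a i + b i - x i)"

end

theory Submission
  imports Defs "HOL-Library.Z2" "HOL-Library.Multiset"
begin

text \<open>
  Suppose that \<open>f x\<close> and \<open>f (- x)\<close> are never equal or adjacent. Then the odd function
  \<open>g x = f x - f (- x)\<close> has at every point a coordinate of absolute value at least \<open>2\<close>. Colour a
  point by such a coordinate together with its sign. Antipodal points get opposite colours, and
  neighbouring points do not, since \<open>g\<close> changes by at most \<open>2\<close> in each coordinate between
  neighbours, whereas opposite colours would need a change of at least \<open>4\<close>. So the theorem follows
  from Tucker's lemma: a colouring of the boundary of an \<open>n\<close>-dimensional box with \<open>n - 1\<close> colours
  and their opposites that respects antipodes has two neighbours of opposite colours
  (\<open>Tucker_sphere\<close>).

  Tucker's lemma needs a box whose centre is a lattice point. The centre of \<open>B\<close> may be half-integral,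
  so the colouring is moved to the boundary of the box \<open>\<Prod> [a\<^sub>i - b\<^sub>i, b\<^sub>i - a\<^sub>i]\<close>, whose points \<open>t\<close>
  stand for the cells of \<open>\<partial>B\<close> with midpoint \<open>(a + b + t) / 2\<close>. A colour may be given to \<open>t\<close> if one of
  the vertices of its cell has it. This keeps the colouring free of conflicts, because any two
  vertices of two neighbouring cells are still \<open>c\<^sub>n\<close>-adjacent or equal.

  Tucker's lemma is proved by a parity count following Ky Fan, with cochains modulo 2. Each unit
  cube is cut into the simplices spanned by its monotone edge paths. Call a simplex positive
  (negative) alternating if its colours, sorted by absolute value, alternate in sign and begin with
  a positive (negative) one; let \<open>A\<^sup>+\<close> and \<open>A\<^sup>-\<close> be the indicators. Two facts carry the count.
  First, the coboundary of \<open>A\<^sup>+\<close> is \<open>A\<^sup>+ + A\<^sup>-\<close> (\<open>cobd_Fan\<close>). Second, the sum of a coboundary over a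
  box is the sum of the cochain over its facets (\<open>box_sum_Stokes\<close>). Let \<open>a k\<close> be the number, modulo
  2, of alternating simplices of either kind in the \<open>k\<close>-dimensional coordinate box through the
  centre. By Stokes, \<open>a (k + 1)\<close> counts the positive simplices on the boundary sphere of the next
  coordinate box. The antipodal map exchanges the two hemispheres, and positive with negative
  simplices, so this is also the number of simplices of either kind on one hemisphere \<open>C\<close>. Together
  with the equatorial \<open>k\<close>-box, \<open>C\<close> bounds a half-box, on which a double coboundary sums to \<open>0\<close>; hence
  the count on \<open>C\<close> equals \<open>a k\<close>. Therefore \<open>a n = a 0 = 1\<close>. But \<open>n\<close> alternating colours without
  opposite pairs have \<open>n\<close> different absolute values, and only \<open>n - 1\<close> are available, so \<open>a n = 0\<close>.
\<close>

section \<open>Sums modulo 2\<close>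

(* These default rules rewrite + to Boolean connectives, which breaks up the sums below. *)
declare add_bit_eq_xor [simp del] mult_bit_eq_and [simp del]

lemma bit_add_self [simp]: "a + a = (0::bit)"
  by (cases a) simp_all

lemma bit_add_eq_0_iff: "a + b = 0 \<longleftrightarrow> a = (b::bit)"
  by (cases a; cases b) simp_all

lemma sum_off_diagonal_insert:
  fixes G :: "'a \<Rightarrow> 'a \<Rightarrow> bit"
  assumes "finite S" "a \<notin> S"
  shows "(\<Sum>i\<in>insert a S. \<Sum>j\<in>insert a S - {i}. G i j)
       = (\<Sum>j\<in>S. G a j) + (\<Sum>i\<in>S. G i a) + (\<Sum>i\<in>S. \<Sum>j\<in>S - {i}. G i j)"
proof -
  have "(\<Sum>j\<in>insert a S - {i}. G i j) = G i a + (\<Sum>j\<in>S - {i}. G i j)" if "i \<in> S" for i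
  proof -
    have "insert a S - {i} = insert a (S - {i})" using that assms by auto
    then show ?thesis using assms by simp
  qed
  then show ?thesis using assms by (simp add: sum.distrib add.assoc)
qed

text \<open>Ordered pairs of distinct elements cancel against their transposes. This is what removes
  the faces inside a cube in \<open>csum_Stokes\<close>.\<close>

lemma sum_off_diagonal_symmetric:
  fixes G :: "'a \<Rightarrow> 'a \<Rightarrow> bit"
  assumes "finite S" "\<And>i j. G i j = G j i"
  shows "(\<Sum>i\<in>S. \<Sum>j\<in>S - {i}. G i j) = 0"
  using assms(1)
proof (induction S)
  case (insert a S)
  have "(\<Sum>j\<in>S. G a j) = (\<Sum>j\<in>S. G j a)" using assms(2) by (intro sum.cong) auto
  then show ?case using insert.IH unfolding sum_off_diagonal_insert[OF insert.hyps] by simp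
qed simp

lemma sum_off_diagonal_swap:
  fixes G :: "'a \<Rightarrow> 'a \<Rightarrow> bit"
  assumes "finite S"
  shows "(\<Sum>i\<in>S. \<Sum>j\<in>S - {i}. G i j) = (\<Sum>j\<in>S. \<Sum>i\<in>S - {j}. G i j)"
  using assms
proof (induction S)
  case (insert a S)
  then show ?case unfolding sum_off_diagonal_insert[OF insert.hyps] by (simp add: add_ac)
qed simp

section \<open>Coboundaries on lists\<close>

text \<open>The usual simplicial coboundary: the sum of \<open>\<phi>\<close> over all lists obtained by deleting one
  entry. The recursion on the head, with \<open>\<phi>\<close> changing, makes the inductions below immediate.\<close>

primrec cobd :: "('a list \<Rightarrow> bit) \<Rightarrow> 'a list \<Rightarrow> bit" where
  "cobd \<phi> [] = 0"
| "cobd \<phi> (x # l) = \<phi> l + cobd (\<lambda>m. \<phi> (x # m)) l"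

lemma cobd_add: "cobd (\<lambda>l. \<phi> l + \<psi> l) l = cobd \<phi> l + cobd \<psi> l"
  by (induction l arbitrary: \<phi> \<psi>) (simp_all add: add_ac)

lemma cobd_cobd: "cobd (cobd \<phi>) l = 0"
  by (induction l arbitrary: \<phi>) (simp_all add: cobd_add)

lemma cobd_map: "cobd (\<lambda>l. \<phi> (map f l)) l = cobd \<phi> (map f l)"
  by (induction l arbitrary: \<phi>) simp_all

text \<open>For a cochain that depends only on the multiset of vertices, so does the coboundary; this
  allows the colours of a simplex to be sorted before its faces are counted.\<close>

lemma cobd_symmetric:
  assumes "\<And>l. \<phi> l = \<psi> (mset l)"
  shows "cobd \<phi> l = (\<Sum>y\<in>#mset l. \<psi> (mset l - {#y#}))"
  using assms
proof (induction l arbitrary: \<phi> \<psi>)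
  case (Cons x l)
  have "cobd (\<lambda>m. \<phi> (x # m)) l = (\<Sum>y\<in>#mset l. \<psi> (add_mset x (mset l - {#y#})))"
    by (rule Cons.IH) (simp add: Cons.prems)
  also have "\<dots> = (\<Sum>y\<in>#mset l. \<psi> (mset (x # l) - {#y#}))"
    by (intro arg_cong[of _ _ sum_mset] image_mset_cong) (auto dest!: multi_member_split)
  finally show ?case by (simp add: Cons.prems)
qed simp

lemma cobd_cong_sorted:
  fixes l :: "'a::linorder list"
  assumes "sorted l" "\<And>m. sorted m \<Longrightarrow> set m \<subseteq> set l \<Longrightarrow> \<phi> m = \<psi> m"
  shows "cobd \<phi> l = cobd \<psi> l"
  using assms
proof (induction l arbitrary: \<phi> \<psi>)
  case (Cons x l)
  have "cobd (\<lambda>m. \<phi> (x # m)) l = cobd (\<lambda>m. \<psi> (x # m)) l"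
    using Cons.prems(1) by (intro Cons.IH Cons.prems(2)) auto
  moreover have "\<phi> l = \<psi> l" using Cons.prems(1) by (intro Cons.prems(2)) auto
  ultimately show ?case by simp
qed simp

section \<open>Alternating colours\<close>

text \<open>A colour is a natural number: \<open>2 * i\<close> encodes the positive and \<open>2 * i + 1\<close> the negative
  colour of absolute value \<open>i\<close>. With this encoding the order of the natural numbers sorts by absolute
  value, and it is total even on opposite colours. So \<open>cobd_Fan\<close> holds for all lists,
  including simplices inside the box, on whose colours nothing is known.\<close>

primrec alternating :: "bool \<Rightarrow> nat list \<Rightarrow> bit" where
  "alternating b [] = 1"
| "alternating b (x # l) = (if even x = b then alternating (\<not> b) l else 0)"

text \<open>In an alternating list with at least two entries, only the deletion of the first or of the
  last one leaves an alternating list, and just one of the two results has the prescribed first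
  sign. In any other list such deletions come in pairs: if a single pair of neighbours has equal
  signs, either of the two may be deleted.\<close>

lemma cobd_alternating: "cobd (alternating b) l = alternating True l + alternating False l"
proof (induction l arbitrary: b)
  case (Cons x l)
  show ?case
  proof (cases "even x = b")
    case True
    then have "(\<lambda>m. alternating b (x # m)) = alternating (\<not> b)" by (auto simp: fun_eq_iff)
    then show ?thesis using True Cons.IH[of "\<not> b"] by (cases b) (auto simp: add_ac)
  next
    case False
    then have "(\<lambda>m. alternating b (x # m)) = (\<lambda>m. 0)" by (auto simp: fun_eq_iff)
    moreover have "cobd (\<lambda>m. 0) l = 0" for l :: "nat list" by (induction l) simp_all
    ultimately show ?thesis using False by (cases b) auto
  qed
qed simp

text \<open>The indicators \<open>A\<^sup>+\<close> (\<open>Fan True\<close>) and \<open>A\<^sup>-\<close> (\<open>Fan False\<close>) of Ky Fan's count.\<close>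

definition Fan :: "bool \<Rightarrow> nat list \<Rightarrow> bit" where
  "Fan b l = alternating b (sort l)"

lemma cobd_Fan: "cobd (Fan b) l = Fan True l + Fan False l"
proof -
  have sym: "Fan b l = alternating b (sorted_list_of_multiset (mset l))" for l
    by (simp add: Fan_def sorted_list_of_multiset_mset)
  have "cobd (Fan b) l = cobd (Fan b) (sort l)"
    by (simp add: cobd_symmetric[where \<psi> = "\<lambda>M. alternating b (sorted_list_of_multiset M)", OF sym])
  also have "\<dots> = cobd (alternating b) (sort l)"
    by (rule cobd_cong_sorted) (auto simp: Fan_def sorted_sort_id)
  finally show ?thesis by (simp add: cobd_alternating Fan_def)
qed

text \<open>The opposite colour.\<close>

definition twin :: "nat \<Rightarrow> nat" where
  "twin c = (if even c then c + 1 else c - 1)"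

lemma even_twin [simp]: "even (twin c) \<longleftrightarrow> odd c"
  by (auto simp: twin_def)

lemma div2_eq_imp: "c div 2 = d div 2 \<Longrightarrow> d = c \<or> d = twin (c::nat)"
  unfolding twin_def by presburger

lemma div2_twin [simp]: "twin c div 2 = c div 2"
  unfolding twin_def by presburger

lemma alternating_twin: "alternating b (map twin l) = alternating (\<not> b) l"
  by (induction l arbitrary: b) auto

text \<open>Without opposite pairs, negating all colours keeps their order, so it only exchanges the
  signs. With a pair \<open>2 * i\<close>, \<open>2 * i + 1\<close> the sorted order would change.\<close>

lemma Fan_twin:
  assumes "\<And>c d. c \<in> set l \<Longrightarrow> d \<in> set l \<Longrightarrow> d \<noteq> twin c"
  shows "Fan b (map twin l) = Fan (\<not> b) l"
proof -
  have "twin c \<le> twin d" if "c \<in> set l" "d \<in> set l" "c \<le> d" for c d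
  proof (cases "c div 2 = d div 2")
    case True
    then show ?thesis using assms that div2_eq_imp by blast
  next
    case False
    then show ?thesis using \<open>c \<le> d\<close> unfolding twin_def by presburger
  qed
  then have "sorted (map twin (sort l))"
    unfolding sorted_map by (intro sorted_wrt_mono_rel[OF _ sorted_sort]) auto
  then have "sort (map twin l) = map twin (sort l)"
    by (intro properties_for_sort) simp
  then show ?thesis by (simp add: Fan_def alternating_twin)
qed

lemma Fan_rev [simp]: "Fan b (rev l) = Fan b l"
  unfolding Fan_def by (intro arg_cong[of _ _ "alternating b"] properties_for_sort) simp_all

text \<open>Neighbours in an alternating sorted list have different signs; so if their absolute values
  were equal they would be opposite.\<close>

lemma alternating_distinct:
  assumes "sorted l" "alternating b l \<noteq> 0" "\<And>c d. c \<in> set l \<Longrightarrow> d \<in> set l \<Longrightarrow> d \<noteq> twin c"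
  shows "sorted_wrt (\<lambda>c d. c div 2 < d div 2) l"
  using assms
proof (induction l arbitrary: b)
  case (Cons x l)
  have tail: "sorted_wrt (\<lambda>c d. c div 2 < d div 2) l"
    using Cons.prems by (intro Cons.IH[of "\<not> b"]) (auto split: if_splits)
  have "x div 2 < y div 2" if y: "y \<in> set l" for y
  proof -
    obtain h t where l: "l = h # t" using y by (cases l) auto
    have "even h \<noteq> even x" using Cons.prems(2) l by (auto split: if_splits)
    moreover have "x \<le> h" using Cons.prems(1) l by auto
    moreover have "h \<noteq> twin x" using Cons.prems(3) l by auto
    ultimately have "x div 2 < h div 2"
      using div2_eq_imp[of x h] div_le_mono[of x h 2] by (auto simp: order.order_iff_strict)
    moreover have "h \<le> y" using Cons.prems(1) l y by auto
    ultimately show ?thesis using div_le_mono[of h y 2] by linarith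
  qed
  with tail show ?case by simp
qed simp

lemma Fan_eq_0:
  assumes "\<And>c d. c \<in> set l \<Longrightarrow> d \<in> set l \<Longrightarrow> d \<noteq> twin c"
    and "\<And>c. c \<in> set l \<Longrightarrow> c div 2 < m" and "m < length l"
  shows "Fan b l = 0"
proof (rule ccontr)
  assume "Fan b l \<noteq> 0"
  then have "sorted_wrt (\<lambda>c d. c div 2 < d div 2) (sort l)"
    using assms(1) by (intro alternating_distinct) (auto simp: Fan_def)
  then have "sorted_wrt (<) (map (\<lambda>c. c div 2) (sort l))" by (simp add: sorted_wrt_map)
  then have "distinct (map (\<lambda>c. c div 2) (sort l))" by (simp add: strict_sorted_iff)
  then have "length l = card (set (map (\<lambda>c. c div 2) (sort l)))"
    by (metis distinct_card length_map length_sort)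
  also have "\<dots> \<le> card {..<m}" using assms(2) by (intro card_mono) auto
  finally show False using assms(3) by simp
qed

section \<open>Sums over the simplices of a unit cube\<close>

text \<open>The sum of \<open>\<phi>\<close> over the monotone edge paths of the unit cube with lowest vertex \<open>x\<close> and
  edge directions \<open>S\<close>, where \<open>k = card S\<close>. The vertex lists of these paths are the top-dimensional
  simplices of the Kuhn (Freudenthal) triangulation of the cube.\<close>

primrec csum :: "nat \<Rightarrow> (point list \<Rightarrow> bit) \<Rightarrow> point \<Rightarrow> nat set \<Rightarrow> bit" where
  "csum 0 \<phi> x S = \<phi> [x]"
| "csum (Suc k) \<phi> x S =
     (\<Sum>i\<in>S. csum k (\<lambda>l. \<phi> (x # l)) (x(i := x i + 1)) (S - {i}))"

lemma csum_add: "csum k (\<lambda>l. \<phi> l + \<psi> l) x S = csum k \<phi> x S + csum k \<psi> x S"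
  by (induction k arbitrary: \<phi> \<psi> x S) (simp_all add: sum.distrib)

text \<open>Stokes for a cube. Deleting the first vertex of a path gives the simplices of the facets
  through the highest vertex, deleting the last one those of the facets through \<open>x\<close>. Deleting an
  inner vertex gives zero in total, as two paths pass around it, with two consecutive directions
  interchanged. In the induction this is the symmetry in the first two directions.\<close>

lemma csum_Stokes:
  assumes "finite S" "card S = Suc k"
  shows "csum (Suc k) (cobd \<phi>) x S =
    (\<Sum>i\<in>S. csum k \<phi> (x(i := x i + 1)) (S - {i}) + csum k \<phi> x (S - {i}))"
  using assms
proof (induction k arbitrary: \<phi> x S)
  case 0
  then obtain i where "S = {i}" by (auto simp: card_1_singleton_iff)
  then show ?case by (simp add: fun_upd_def)
next
  case (Suc k)
  let ?e = "\<lambda>x i. x(i := x i + 1)"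
  let ?\<phi> = "\<lambda>l. \<phi> (x # l)"
  have IH: "csum (Suc k) (cobd ?\<phi>) (?e x i) (S - {i}) =
     (\<Sum>j\<in>S - {i}. csum k ?\<phi> (?e (?e x i) j) (S - {i} - {j}) + csum k ?\<phi> (?e x i) (S - {i} - {j}))"
    if "i \<in> S" for i
    using Suc.prems that by (intro Suc.IH) auto
  have swap: "?e (?e x i) j = ?e (?e x j) i" for i j by (auto simp: fun_eq_iff)
  have set: "S - {i} - {j} = S - {j} - {i}" for i j by auto
  have "csum (Suc (Suc k)) (cobd \<phi>) x S =
      (\<Sum>i\<in>S. csum (Suc k) \<phi> (?e x i) (S - {i}) + csum (Suc k) (cobd ?\<phi>) (?e x i) (S - {i}))"
    by (subst csum.simps(2)) (simp add: csum_add del: csum.simps)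
  also have "\<dots> = (\<Sum>i\<in>S. csum (Suc k) \<phi> (?e x i) (S - {i})) +
     ((\<Sum>i\<in>S. \<Sum>j\<in>S - {i}. csum k ?\<phi> (?e (?e x i) j) (S - {i} - {j})) +
      (\<Sum>i\<in>S. \<Sum>j\<in>S - {i}. csum k ?\<phi> (?e x i) (S - {i} - {j})))"
    by (simp add: sum.distrib IH del: csum.simps)
  also have "(\<Sum>i\<in>S. \<Sum>j\<in>S - {i}. csum k ?\<phi> (?e (?e x i) j) (S - {i} - {j})) = 0"
    using Suc.prems(1) by (rule sum_off_diagonal_symmetric) (metis swap set)
  also have "(\<Sum>i\<in>S. \<Sum>j\<in>S - {i}. csum k ?\<phi> (?e x i) (S - {i} - {j})) =
      (\<Sum>j\<in>S. \<Sum>i\<in>S - {j}. csum k ?\<phi> (?e x i) (S - {j} - {i}))"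
    by (subst sum_off_diagonal_swap[OF Suc.prems(1)]) (simp add: set)
  also have "\<dots> = (\<Sum>j\<in>S. csum (Suc k) \<phi> x (S - {j}))" by simp
  finally show ?case by (simp add: sum.distrib del: csum.simps)
qed

definition far_corner :: "point \<Rightarrow> nat set \<Rightarrow> point" where
  "far_corner x S = (\<lambda>i. if i \<in> S then x i + 1 else x i)"

text \<open>The recursion of \<open>csum\<close> seen from the last direction of the path instead of the first.\<close>

lemma csum_last:
  assumes "finite S" "card S = Suc k"
  shows "csum (Suc k) \<phi> x S = (\<Sum>i\<in>S. csum k (\<lambda>l. \<phi> (l @ [far_corner x S])) x (S - {i}))"
  using assms
proof (induction k arbitrary: \<phi> x S)
  case 0
  then obtain i where "S = {i}" by (auto simp: card_1_singleton_iff)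
  moreover have "far_corner x {i} = x(i := x i + 1)" by (auto simp: far_corner_def fun_eq_iff)
  ultimately show ?case by (simp add: fun_upd_def)
next
  case (Suc k)
  let ?e = "\<lambda>x i. x(i := x i + 1)"
  have IH: "csum (Suc k) (\<lambda>l. \<phi> (x # l)) (?e x i) (S - {i}) =
     (\<Sum>j\<in>S - {i}. csum k (\<lambda>l. \<phi> (x # l @ [far_corner x S])) (?e x i) (S - {i} - {j}))"
    if "i \<in> S" for i
  proof -
    have "far_corner (?e x i) (S - {i}) = far_corner x S"
      using that by (auto simp: far_corner_def fun_eq_iff)
    then show ?thesis using Suc.prems that by (subst Suc.IH) auto
  qed
  have set: "S - {i} - {j} = S - {j} - {i}" for i j by auto
  have "csum (Suc (Suc k)) \<phi> x S =
     (\<Sum>i\<in>S. \<Sum>j\<in>S - {i}. csum k (\<lambda>l. \<phi> (x # l @ [far_corner x S])) (?e x i) (S - {i} - {j}))"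
    by (subst csum.simps(2)) (simp add: IH del: csum.simps)
  also have "\<dots> = (\<Sum>j\<in>S. \<Sum>i\<in>S - {j}. csum k (\<lambda>l. \<phi> (x # l @ [far_corner x S])) (?e x i) (S - {j} - {i}))"
    by (subst sum_off_diagonal_swap[OF Suc.prems(1)]) (simp add: set)
  finally show ?case by simp
qed

text \<open>Point reflection turns monotone paths into monotone paths run backwards, so it preserves
  the triangulation. The reflected cube has the reflected highest vertex as its lowest one.\<close>

lemma csum_reflect:
  assumes "finite S" "card S = k"
  shows "csum k \<phi> (- far_corner x S) S = csum k (\<lambda>l. \<phi> (rev (map uminus l))) x S"
  using assms
proof (induction k arbitrary: \<phi> S)
  case 0
  then show ?case by (simp add: far_corner_def fun_eq_iff)
next
  case (Suc k)
  let ?y = "- far_corner x S"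
  have "csum k (\<lambda>l. \<phi> (?y # l)) (?y(i := ?y i + 1)) (S - {i}) =
      csum k (\<lambda>l. \<phi> (?y # rev (map uminus l))) x (S - {i})" if "i \<in> S" for i
  proof -
    have "?y(i := ?y i + 1) = - far_corner x (S - {i})"
      using that by (auto simp: far_corner_def fun_eq_iff)
    moreover have "csum k \<psi> (- far_corner x (S - {i})) (S - {i}) =
        csum k (\<lambda>l. \<psi> (rev (map uminus l))) x (S - {i})" for \<psi>
      using Suc.prems that by (intro Suc.IH) auto
    ultimately show ?thesis by (simp only:)
  qed
  then have "csum (Suc k) \<phi> ?y S = (\<Sum>i\<in>S. csum k (\<lambda>l. \<phi> (?y # rev (map uminus l))) x (S - {i}))"
    by simp
  then show ?case by (subst csum_last[OF Suc.prems]) simp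
qed

definition unit_cube :: "point \<Rightarrow> nat set \<Rightarrow> point set" where
  "unit_cube x S = {y. \<forall>i. x i \<le> y i \<and> y i \<le> far_corner x S i}"

lemma csum_cong:
  assumes "finite S" "card S = k"
    and "\<And>l. length l = Suc k \<Longrightarrow> set l \<subseteq> unit_cube x S \<Longrightarrow> \<phi> l = \<psi> l"
  shows "csum k \<phi> x S = csum k \<psi> x S"
  using assms
proof (induction k arbitrary: \<phi> \<psi> x S)
  case 0
  then show ?case by (simp add: unit_cube_def far_corner_def)
next
  case (Suc k)
  have "csum k (\<lambda>l. \<phi> (x # l)) (x(i := x i + 1)) (S - {i}) =
      csum k (\<lambda>l. \<psi> (x # l)) (x(i := x i + 1)) (S - {i})" if "i \<in> S" for i
  proof (rule Suc.IH)
    fix l assume l: "length l = Suc k" "set l \<subseteq> unit_cube (x(i := x i + 1)) (S - {i})"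
    have "y \<in> unit_cube x S" if "y \<in> unit_cube (x(i := x i + 1)) (S - {i})" for y
      unfolding unit_cube_def mem_Collect_eq
    proof
      fix j
      show "x j \<le> y j \<and> y j \<le> far_corner x S j"
        using that \<open>i \<in> S\<close> unfolding unit_cube_def mem_Collect_eq far_corner_def
        by (auto dest!: spec[of _ j] split: if_splits)
    qed
    moreover have "x \<in> unit_cube x S" by (simp add: unit_cube_def far_corner_def)
    ultimately show "\<phi> (x # l) = \<psi> (x # l)" using l by (intro Suc.prems(3)) auto
  qed (use Suc.prems that in auto)
  then show ?case by simp
qed


section \<open>Sums over boxes\<close>

text \<open>The lowest vertices of the unit cubes that make up the box with directions \<open>D\<close> and bounds
  \<open>lo\<close> and \<open>hi\<close>. Outside \<open>D\<close> the coordinates are those of \<open>z\<close>, so that faces of boxes have the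
  same form.\<close>

definition box_base :: "point \<Rightarrow> point \<Rightarrow> nat set \<Rightarrow> point \<Rightarrow> point set" where
  "box_base lo hi D z = {x. \<forall>i. if i \<in> D then lo i \<le> x i \<and> x i < hi i else x i = z i}"

lemma box_base_empty [simp]: "box_base lo hi {} z = {z}"
  by (auto simp: box_base_def)

lemma box_base_remove:
  assumes "i \<in> D"
  shows "box_base lo hi D z =
    (\<lambda>(y, t). y(i := t)) ` (box_base lo hi (D - {i}) z \<times> {lo i..<hi i})"
proof (intro equalityI subsetI)
  fix x assume x: "x \<in> box_base lo hi D z"
  then have "x i \<in> {lo i..<hi i}" using assms by (auto simp: box_base_def dest: spec[of _ i])
  moreover have "x(i := z i) \<in> box_base lo hi (D - {i}) z" using x by (auto simp: box_base_def)
  moreover have "x = (\<lambda>(y, t). y(i := t)) (x(i := z i), x i)" by simp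
  ultimately show "x \<in> (\<lambda>(y, t). y(i := t)) ` (box_base lo hi (D - {i}) z \<times> {lo i..<hi i})"
    by blast
next
  fix x assume "x \<in> (\<lambda>(y, t). y(i := t)) ` (box_base lo hi (D - {i}) z \<times> {lo i..<hi i})"
  then show "x \<in> box_base lo hi D z" using assms by (auto simp: box_base_def split: if_splits)
qed

lemma finite_box_base: "finite D \<Longrightarrow> finite (box_base lo hi D z)"
proof (induction D rule: finite_induct)
  case (insert i D)
  then show ?case by (subst box_base_remove[of i]) auto
qed simp

lemma sum_box_base:
  assumes "i \<in> D"
  shows "sum G (box_base lo hi D z) =
    (\<Sum>y\<in>box_base lo hi (D - {i}) z. \<Sum>t\<in>{lo i..<hi i}. G (y(i := t)))"
proof -
  have fixed: "y i = z i" if "y \<in> box_base lo hi (D - {i}) z" for y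
    using that by (auto simp: box_base_def dest: spec[of _ i])
  have "inj_on (\<lambda>(y, t). y(i := t)) (box_base lo hi (D - {i}) z \<times> {lo i..<hi i})"
  proof (rule inj_onI, clarify)
    fix y t y' t'
    assume y: "y \<in> box_base lo hi (D - {i}) z" "y' \<in> box_base lo hi (D - {i}) z"
      and eq: "y(i := t) = y'(i := t')"
    have "y j = y' j" for j
      using fun_cong[OF eq, of j] fixed[OF y(1)] fixed[OF y(2)] by (cases "j = i") auto
    then show "y = y' \<and> t = t'" using fun_cong[OF eq, of i] by auto
  qed
  then show ?thesis
    by (simp add: box_base_remove[OF assms] sum.reindex sum.cartesian_product case_prod_unfold)
qed

lemma sum_box_base_fixed:
  assumes "i \<notin> D"
  shows "sum G (box_base lo hi D (z(i := t))) = (\<Sum>y\<in>box_base lo hi D z. G (y(i := t)))"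
proof -
  have "x(i := t) = x" if "x \<in> box_base lo hi D (z(i := t))" for x
    using that assms by (auto simp: box_base_def dest: spec[of _ i])
  moreover have "y(i := z i) = y" if "y \<in> box_base lo hi D z" for y
    using that assms by (auto simp: box_base_def dest: spec[of _ i])
  ultimately show ?thesis
    using assms
    by (intro sum.reindex_bij_witness[of _ "\<lambda>y. y(i := t)" "\<lambda>x. x(i := z i)"])
      (simp_all, auto simp: box_base_def split: if_splits)
qed

lemma sum_telescope_bit:
  fixes g :: "int \<Rightarrow> bit"
  assumes "u \<le> v"
  shows "(\<Sum>t\<in>{u..<v}. g (t + 1) + g t) = g v + g u"
  using assms
proof (induction v rule: int_ge_induct)
  case (step v)
  have "{u..<v + 1} = insert v {u..<v}" using step.hyps by auto
  then show ?case using step by (simp add: add_ac)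
qed simp

definition box_sum ::
  "(point list \<Rightarrow> bit) \<Rightarrow> point \<Rightarrow> point \<Rightarrow> nat set \<Rightarrow> point \<Rightarrow> bit" where
  "box_sum \<phi> lo hi D z = (\<Sum>x\<in>box_base lo hi D z. csum (card D) \<phi> x D)"

lemma box_sum_add:
  "box_sum (\<lambda>l. \<phi> l + \<psi> l) lo hi D z = box_sum \<phi> lo hi D z + box_sum \<psi> lo hi D z"
  by (simp add: box_sum_def csum_add sum.distrib)

lemma box_sum_zero: "box_sum (\<lambda>_. 0) lo hi D z = 0"
proof -
  have "csum k (\<lambda>_. 0) x S = 0" for k x S by (induction k arbitrary: x S) simp_all
  then show ?thesis by (simp add: box_sum_def)
qed

text \<open>Applying Stokes to each cube, the facets orthogonal to a direction \<open>i\<close> telescope along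
  \<open>i\<close>, leaving the two extreme layers.\<close>

lemma box_sum_Stokes:
  assumes "finite D" "D \<noteq> {}" "\<And>i. i \<in> D \<Longrightarrow> lo i \<le> hi i"
  shows "box_sum (cobd \<phi>) lo hi D z =
    (\<Sum>i\<in>D. box_sum \<phi> lo hi (D - {i}) (z(i := hi i)) + box_sum \<phi> lo hi (D - {i}) (z(i := lo i)))"
proof -
  obtain k where k: "card D = Suc k" using assms(1,2) by (metis card_0_eq not0_implies_Suc)
  let ?G = "\<lambda>i x. csum k \<phi> x (D - {i})"
  have "box_sum (cobd \<phi>) lo hi D z =
      (\<Sum>i\<in>D. \<Sum>x\<in>box_base lo hi D z. ?G i (x(i := x i + 1)) + ?G i x)"
    unfolding box_sum_def k
    by (subst sum.swap) (simp only: csum_Stokes[OF assms(1) k])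
  also have "\<dots> = (\<Sum>i\<in>D. \<Sum>y\<in>box_base lo hi (D - {i}) z. ?G i (y(i := hi i)) + ?G i (y(i := lo i)))"
  proof (rule sum.cong[OF refl])
    fix i assume i: "i \<in> D"
    have "(\<Sum>t\<in>{lo i..<hi i}. ?G i (y(i := t + 1)) + ?G i (y(i := t))) =
        ?G i (y(i := hi i)) + ?G i (y(i := lo i))" for y
      using sum_telescope_bit[OF assms(3)[OF i], of "\<lambda>t. ?G i (y(i := t))"] .
    then show "(\<Sum>x\<in>box_base lo hi D z. ?G i (x(i := x i + 1)) + ?G i x) =
        (\<Sum>y\<in>box_base lo hi (D - {i}) z. ?G i (y(i := hi i)) + ?G i (y(i := lo i)))"
      by (simp add: sum_box_base[OF i])
  qed
  also have "\<dots> = (\<Sum>i\<in>D. box_sum \<phi> lo hi (D - {i}) (z(i := hi i)) + box_sum \<phi> lo hi (D - {i}) (z(i := lo i)))"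
    by (rule sum.cong[OF refl]) (simp add: box_sum_def k sum_box_base_fixed sum.distrib)
  finally show ?thesis .
qed

lemma box_sum_reflect:
  assumes "finite D"
  shows "box_sum \<phi> lo hi D z = box_sum (\<lambda>l. \<phi> (rev (map uminus l))) (- hi) (- lo) D (- z)"
proof -
  have *: "- far_corner x D \<in> box_base (- hi) (- lo) D (- z)"
    if "x \<in> box_base lo hi D z" for x lo hi z
    unfolding box_base_def mem_Collect_eq
  proof
    fix i
    show "if i \<in> D then (- hi) i \<le> (- far_corner x D) i \<and> (- far_corner x D) i < (- lo) i
      else (- far_corner x D) i = (- z) i"
      using that unfolding box_base_def far_corner_def by (auto dest!: spec[of _ i] split: if_splits)
  qed
  have neg: "- (- p) = p" for p :: point by (simp add: fun_eq_iff)
  have inv: "- far_corner (- far_corner x D) D = x" for x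
    by (auto simp: far_corner_def fun_eq_iff)
  have "box_sum (\<lambda>l. \<phi> (rev (map uminus l))) (- hi) (- lo) D (- z) =
      (\<Sum>x\<in>box_base (- hi) (- lo) D (- z). csum (card D) \<phi> (- far_corner x D) D)"
    unfolding box_sum_def by (simp add: csum_reflect[OF assms refl])
  also have "\<dots> = box_sum \<phi> lo hi D z"
    unfolding box_sum_def
    by (rule sum.reindex_bij_witness[of _ "\<lambda>x. - far_corner x D" "\<lambda>x. - far_corner x D"])
      (use * *[of _ "- hi" "- lo" "- z"] inv in \<open>auto simp: neg\<close>)
  finally show ?thesis by simp
qed

definition closed_box :: "point \<Rightarrow> point \<Rightarrow> nat set \<Rightarrow> point \<Rightarrow> point set" where
  "closed_box lo hi D z = {x. \<forall>i. if i \<in> D then lo i \<le> x i \<and> x i \<le> hi i else x i = z i}"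

text \<open>Only lists of points of the box that lie in a common unit cube contribute. All facts about
  a colouring of the boundary enter the count through this lemma.\<close>

lemma box_sum_cong:
  assumes "finite D"
    and "\<And>l. length l = Suc (card D) \<Longrightarrow> set l \<subseteq> closed_box lo hi D z \<Longrightarrow>
      (\<And>x y i. x \<in> set l \<Longrightarrow> y \<in> set l \<Longrightarrow> \<bar>x i - y i\<bar> \<le> 1) \<Longrightarrow> \<phi> l = \<psi> l"
  shows "box_sum \<phi> lo hi D z = box_sum \<psi> lo hi D z"
  unfolding box_sum_def
proof (rule sum.cong[OF refl], rule csum_cong[OF assms(1) refl])
  fix x l
  assume x: "x \<in> box_base lo hi D z" and l: "length l = Suc (card D)" "set l \<subseteq> unit_cube x D"
  have "y \<in> closed_box lo hi D z" if "y \<in> unit_cube x D" for y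
    unfolding closed_box_def mem_Collect_eq
  proof
    fix i
    show "if i \<in> D then lo i \<le> y i \<and> y i \<le> hi i else y i = z i"
      using that x unfolding unit_cube_def box_base_def far_corner_def
      by (auto dest!: spec[of _ i] split: if_splits)
  qed
  moreover have "\<bar>y i - y' i\<bar> \<le> 1" if "y \<in> unit_cube x D" "y' \<in> unit_cube x D" for y y' i
    using that unfolding unit_cube_def far_corner_def
    by (auto dest!: spec[of _ i] split: if_splits)
  ultimately show "\<phi> l = \<psi> l" using l by (intro assms(2)) blast+
qed

lemma box_sum_bounds_cong:
  assumes "\<And>i. i \<in> D \<Longrightarrow> lo i = lo' i" "\<And>i. i \<in> D \<Longrightarrow> hi i = hi' i"
  shows "box_sum \<phi> lo hi D z = box_sum \<phi> lo' hi' D z"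
proof -
  have "box_base lo hi D z = box_base lo' hi' D z" using assms by (auto simp: box_base_def)
  then show ?thesis by (simp add: box_sum_def)
qed

lemma box_sum_split:
  assumes "finite D" "j \<in> D" "lo j \<le> c" "c \<le> hi j"
  shows "box_sum \<phi> lo hi D z = box_sum \<phi> (lo(j := c)) hi D z + box_sum \<phi> lo (hi(j := c)) D z"
proof -
  have "box_base lo hi D z = box_base (lo(j := c)) hi D z \<union> box_base lo (hi(j := c)) D z"
  proof (intro equalityI subsetI)
    fix x assume "x \<in> box_base lo hi D z"
    then show "x \<in> box_base (lo(j := c)) hi D z \<union> box_base lo (hi(j := c)) D z"
      using assms(2) by (cases "x j < c") (auto simp: box_base_def)
  next
    fix x assume "x \<in> box_base (lo(j := c)) hi D z \<union> box_base lo (hi(j := c)) D z"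
    then show "x \<in> box_base lo hi D z"
    proof
      assume x: "x \<in> box_base (lo(j := c)) hi D z"
      show ?thesis
        unfolding box_base_def mem_Collect_eq
      proof
        fix i
        show "if i \<in> D then lo i \<le> x i \<and> x i < hi i else x i = z i"
          using x assms(3) unfolding box_base_def
          by (auto dest!: spec[of _ i] split: if_splits)
      qed
    next
      assume x: "x \<in> box_base lo (hi(j := c)) D z"
      show ?thesis
        unfolding box_base_def mem_Collect_eq
      proof
        fix i
        show "if i \<in> D then lo i \<le> x i \<and> x i < hi i else x i = z i"
          using x assms(4) unfolding box_base_def
          by (auto dest!: spec[of _ i] split: if_splits)
      qed
    qed
  qed
  moreover have "box_base (lo(j := c)) hi D z \<inter> box_base lo (hi(j := c)) D z = {}"
    using assms(2) by (fastforce simp: box_base_def dest: spec[of _ j])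
  ultimately show ?thesis
    unfolding box_sum_def using finite_box_base[OF assms(1)] by (simp add: sum.union_disjoint)
qed

section \<open>Tucker's lemma on the boundary of a symmetric box\<close>

text \<open>The parity argument. The coordinate boxes in it pass through the interior, where the values
  of \<open>L\<close> are arbitrary; the hypotheses are used only on those facets of boxes on which one
  coordinate is extreme, and these lie in the boundary.\<close>

lemma Tucker_sphere:
  fixes n :: nat and M :: "nat \<Rightarrow> int" and L :: "point \<Rightarrow> nat"
  defines "Bd \<equiv> {x. (\<forall>i\<in>{1..n}. \<bar>x i\<bar> \<le> M i) \<and> (\<exists>i\<in>{1..n}. \<bar>x i\<bar> = M i)}"
  assumes "n \<ge> 1" and M: "\<And>i. i \<in> {1..n} \<Longrightarrow> 0 \<le> M i"
    and anti: "\<And>x. x \<in> Bd \<Longrightarrow> L (- x) = twin (L x)"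
    and range: "\<And>x. x \<in> Bd \<Longrightarrow> L x div 2 < n - 1"
  shows "\<exists>x\<in>Bd. \<exists>y\<in>Bd. (\<forall>i\<in>{1..n}. \<bar>x i - y i\<bar> \<le> 1) \<and> L y = twin (L x)"
proof (rule ccontr)
  assume "\<not> ?thesis"
  then have nc: "L y \<noteq> twin (L x)"
    if "x \<in> Bd" "y \<in> Bd" "\<And>i. \<bar>x i - y i\<bar> \<le> 1" for x y
    using that by blast
  define A where "A b l = Fan b (map L l)" for b l
  define org :: point where "org = (\<lambda>_. 0)"
  define a where "a k = box_sum (cobd (A True)) (- M) M {1..k} org" for k
  have cobd_A: "cobd (A True) = (\<lambda>l. A True l + A False l)"
    unfolding A_def cobd_map cobd_Fan ..
  have face: "closed_box lo hi D (org(i := c)) \<subseteq> Bd"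
    if "D \<subseteq> {1..n}" "i \<in> {1..n}" "i \<notin> D" "\<bar>c\<bar> = M i"
      "\<And>j. j \<in> D \<Longrightarrow> - M j \<le> lo j" "\<And>j. j \<in> D \<Longrightarrow> hi j \<le> M j" for lo hi D i c
  proof
    fix x assume x: "x \<in> closed_box lo hi D (org(i := c))"
    have "\<bar>x i\<bar> = M i" using x that(3,4) by (auto simp: closed_box_def dest!: spec[of _ i])
    moreover have "\<bar>x j\<bar> \<le> M j" if "j \<in> {1..n}" for j
    proof (cases "j \<in> D")
      case True
      then show ?thesis
        using x \<open>j \<in> D \<Longrightarrow> - M j \<le> lo j\<close> \<open>j \<in> D \<Longrightarrow> hi j \<le> M j\<close>
        by (fastforce simp: closed_box_def dest!: spec[of _ j])
    next
      case False
      then show ?thesis using x M[OF that] \<open>\<bar>c\<bar> = M i\<close>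
        by (auto simp: closed_box_def org_def dest!: spec[of _ j] split: if_splits)
    qed
    ultimately show "x \<in> Bd" unfolding Bd_def using that(2) by blast
  qed
  have reflect: "box_sum (A True) lo hi D (org(i := c)) = box_sum (A False) (- hi) (- lo) D (org(i := - c))"
    if "D \<subseteq> {1..n}" "i \<in> {1..n}" "i \<notin> D" "\<bar>c\<bar> = M i"
      "\<And>j. j \<in> D \<Longrightarrow> - M j \<le> lo j" "\<And>j. j \<in> D \<Longrightarrow> hi j \<le> M j" for lo hi D i c
  proof -
    have fin: "finite D" using that(1) finite_subset by blast
    have org: "- (org(i := c)) = org(i := - c)" by (auto simp: org_def)
    show ?thesis
      unfolding box_sum_reflect[OF fin, of "A True"] org
    proof (rule box_sum_cong[OF fin])
      fix l assume l: "set l \<subseteq> closed_box (- hi) (- lo) D (org(i := - c))"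
        and adj: "\<And>x y i. x \<in> set l \<Longrightarrow> y \<in> set l \<Longrightarrow> \<bar>x i - y i\<bar> \<le> 1"
      have "closed_box (- hi) (- lo) D (org(i := - c)) \<subseteq> Bd"
        using that by (intro face) force+
      with l have Bd: "x \<in> Bd" if "x \<in> set l" for x using that by blast
      have "map L (map uminus l) = map twin (map L l)" using anti Bd by simp
      then have "A True (rev (map uminus l)) = Fan True (map twin (map L l))"
        by (simp add: A_def rev_map[symmetric] del: map_map)
      also have "\<dots> = A False l"
        unfolding A_def using Fan_twin[of "map L l" True] nc Bd adj by fastforce
      finally show "A True (rev (map uminus l)) = A False l" .
    qed
  qed
  \<comment> \<open>The box in the directions \<open>1, \<dots>, j\<close> is halved by the hyperplane where coordinate \<open>j\<close> vanishes.
    \<open>F\<close> sums over the equatorial facet of the two halves, and \<open>C\<close> over the other facets of the upper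
    half, which form the upper hemisphere.\<close>
  have step: "a (Suc k) = a k" if "k < n" for k
  proof -
    define j where "j = Suc k"
    define D where "D = {1..j}"
    define lo where "lo = (- M)(j := 0)"
    define hi where "hi = M(j := 0)"
    define F where "F \<phi> = box_sum \<phi> (- M) M {1..k} org" for \<phi>
    define C where "C \<phi> = box_sum \<phi> lo M {1..k} (org(j := M j)) +
      (\<Sum>i\<in>{1..k}. box_sum \<phi> lo M (D - {i}) (org(i := M i)) + box_sum \<phi> lo M (D - {i}) (org(i := - M i)))" for \<phi>
    have D: "D = insert j {1..k}" "j \<notin> {1..k}" "D - {j} = {1..k}" "finite D" "D \<noteq> {}" "D \<subseteq> {1..n}"
      using that by (auto simp: D_def j_def)
    have j: "j \<in> D" "0 \<le> M j" using that M by (auto simp: D_def j_def)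
    have upd: "org(j := 0) = org" by (auto simp: org_def)
    have sub: "D - {i} \<subseteq> {1..n}" "i \<in> {1..n}" "\<bar>M i\<bar> = M i" "\<bar>- M i\<bar> = M i" if "i \<in> D" for i
      using that D(6) M[of i] by auto
    have bounds: "- M i \<le> lo i" "lo i \<le> M i" "hi i \<le> M i" "- M i \<le> hi i" if "i \<in> D" for i
      using that D(6) M[of i] by (auto simp: lo_def hi_def)
    have mhi: "- hi = lo" "- (- M) = M" by (auto simp: hi_def lo_def fun_eq_iff)
    have upper: "box_sum (cobd \<phi>) lo M D org = F \<phi> + C \<phi>" for \<phi>
    proof -
      have "box_sum \<phi> lo M {1..k} org = F \<phi>"
        unfolding F_def by (rule box_sum_bounds_cong) (auto simp: lo_def j_def)
      moreover have "box_sum \<phi> lo M (D - {i}) (org(i := lo i)) = box_sum \<phi> lo M (D - {i}) (org(i := - M i))"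
        if "i \<in> {1..k}" for i using that by (simp add: lo_def j_def)
      moreover have "lo j = 0" by (simp add: lo_def)
      ultimately show ?thesis
        using D bounds by (subst box_sum_Stokes) (auto simp: D(1) C_def upd add_ac)
    qed
    \<comment> \<open>The facets of the lower half other than the equatorial one are the antipodes of those in \<open>C\<close>.\<close>
    have "box_sum (cobd (A True)) (- M) hi D org = F (A True) + C (A False)"
    proof -
      have refl_facet: "box_sum (A True) (- M) hi (D - {i}) (org(i := c)) =
          box_sum (A False) lo M (D - {i}) (org(i := - c))"
        if "i \<in> D" "\<bar>c\<bar> = M i" for i c
        using that sub[OF that(1)] bounds by (subst reflect) (auto simp: mhi)
      have facets: "box_sum (A True) (- M) hi (D - {i}) (org(i := hi i)) + box_sum (A True) (- M) hi (D - {i}) (org(i := (- M) i)) =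
          box_sum (A False) lo M (D - {i}) (org(i := M i)) + box_sum (A False) lo M (D - {i}) (org(i := - M i))"
        if "i \<in> {1..k}" for i
      proof -
        have i: "i \<in> D" "hi i = M i" using that by (auto simp: D_def j_def hi_def)
        show ?thesis using sub[OF i(1)] i by (simp add: refl_facet add.commute)
      qed
      have "box_sum (A True) (- M) hi {1..k} org = F (A True)"
        unfolding F_def by (rule box_sum_bounds_cong) (auto simp: hi_def j_def)
      moreover have "box_sum (A True) (- M) hi {1..k} (org(j := - M j)) = box_sum (A False) lo M {1..k} (org(j := M j))"
        using refl_facet[OF j(1), of "- M j"] D(3) j by simp
      moreover have "hi j = 0" by (simp add: hi_def)
      moreover have "box_sum (cobd (A True)) (- M) hi D org =
        (\<Sum>i\<in>D. box_sum (A True) (- M) hi (D - {i}) (org(i := hi i)) + box_sum (A True) (- M) hi (D - {i}) (org(i := (- M) i)))"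
        using D bounds by (intro box_sum_Stokes) auto
      moreover have "\<dots> = (box_sum (A True) (- M) hi {1..k} (org(j := hi j)) + box_sum (A True) (- M) hi {1..k} (org(j := (- M) j))) +
        (\<Sum>i\<in>{1..k}. box_sum (A False) lo M (D - {i}) (org(i := M i)) + box_sum (A False) lo M (D - {i}) (org(i := - M i)))"
        using D(2,3) facets by (subst (1) D(1)) simp
      ultimately show ?thesis by (simp add: C_def upd add_ac)
    qed
    moreover have "a (Suc k) = box_sum (cobd (A True)) lo M D org + box_sum (cobd (A True)) (- M) hi D org"
      unfolding a_def lo_def hi_def D_def j_def[symmetric]
      by (rule box_sum_split) (use j in \<open>auto simp: D_def\<close>)
    ultimately have "a (Suc k) = C (A True) + C (A False)"
      by (simp add: upper add_ac)
    also have "\<dots> = C (cobd (A True))"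
      unfolding C_def cobd_A box_sum_add sum.distrib by (simp add: add_ac)
    \<comment> \<open>\<open>F\<close> and \<open>C\<close> together are the whole boundary of the upper half-box.\<close>
    also have "\<dots> = F (cobd (A True))"
    proof -
      have "F (cobd (A True)) + C (cobd (A True)) = box_sum (cobd (cobd (A True))) lo M D org"
        by (simp add: upper)
      also have "\<dots> = 0" by (simp add: cobd_cobd[abs_def] box_sum_zero)
      finally show ?thesis by (simp add: bit_add_eq_0_iff)
    qed
    finally show ?thesis by (simp add: F_def a_def)
  qed
  have "k \<le> n \<Longrightarrow> a k = 1" for k
  proof (induction k)
    case 0
    show ?case by (simp add: a_def box_sum_def A_def Fan_def)
  next
    case (Suc k)
    then show ?case using step[of k] by simp
  qed
  then have "a n = 1" by blast
  moreover have "a n = 0"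
  proof -
    have zero: "box_sum (A True) (- M) M ({1..n} - {i}) (org(i := c)) = 0"
      if "i \<in> {1..n}" "\<bar>c\<bar> = M i" for i c
    proof -
      have "box_sum (A True) (- M) M ({1..n} - {i}) (org(i := c)) =
          box_sum (\<lambda>_. 0) (- M) M ({1..n} - {i}) (org(i := c))"
      proof (rule box_sum_cong)
        fix l assume len: "length l = Suc (card ({1..n} - {i}))"
          and l: "set l \<subseteq> closed_box (- M) M ({1..n} - {i}) (org(i := c))"
          and adj: "\<And>x y i. x \<in> set l \<Longrightarrow> y \<in> set l \<Longrightarrow> \<bar>x i - y i\<bar> \<le> 1"
        have "closed_box (- M) M ({1..n} - {i}) (org(i := c)) \<subseteq> Bd"
          using that by (intro face) auto
        with l have Bd: "x \<in> Bd" if "x \<in> set l" for x using that by blast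
        have "length l = n" using len that(1) by simp
        then show "A True l = 0"
          unfolding A_def
        proof (intro Fan_eq_0[where m = "n - 1"])
          fix c d assume "c \<in> set (map L l)" "d \<in> set (map L l)"
          then obtain x y where xy: "x \<in> set l" "c = L x" "y \<in> set l" "d = L y" by auto
          show "d \<noteq> twin c"
            unfolding xy using nc[OF Bd[OF xy(1)] Bd[OF xy(3)] adj[OF xy(1,3)]] .
        qed (use range Bd \<open>n \<ge> 1\<close> in auto)
      qed simp
      also have "\<dots> = 0" by (rule box_sum_zero)
      finally show ?thesis .
    qed
    have "a n = (\<Sum>i\<in>{1..n}. box_sum (A True) (- M) M ({1..n} - {i}) (org(i := M i)) +
        box_sum (A True) (- M) M ({1..n} - {i}) (org(i := (- M) i)))"
      unfolding a_def using \<open>n \<ge> 1\<close> M by (intro box_sum_Stokes) force+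
    also have "\<dots> = 0"
    proof (intro sum.neutral ballI)
      fix i assume i: "i \<in> {1..n}"
      then show "box_sum (A True) (- M) M ({1..n} - {i}) (org(i := M i)) +
          box_sum (A True) (- M) M ({1..n} - {i}) (org(i := (- M) i)) = 0"
        using zero[OF i, of "M i"] zero[OF i, of "- M i"] M[OF i] by simp
    qed
    finally show ?thesis .
  qed
  ultimately show False by simp
qed


section \<open>Maps from the boundary of a box\<close>

lemma c_adj_full_iff:
  "c_adj n n x y \<longleftrightarrow> x \<in> int_lattice n \<and> y \<in> int_lattice n \<and> x \<noteq> y \<and> (\<forall>i\<in>{1..n}. \<bar>x i - y i\<bar> \<le> 1)"
  (is "?l \<longleftrightarrow> ?r")
proof
  assume ?l
  then obtain S where S: "x \<in> int_lattice n" "y \<in> int_lattice n" "x \<noteq> y"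
    "\<forall>i\<in>S. \<bar>x i - y i\<bar> \<le> 1" "\<forall>i\<in>{1..n} - S. x i = y i"
    unfolding c_adj_def by blast
  have "\<bar>x i - y i\<bar> \<le> 1" if "i \<in> {1..n}" for i using S(4,5) that by (cases "i \<in> S") auto
  with S show ?r by blast
next
  assume ?r
  then show ?l unfolding c_adj_def by (auto intro!: exI[of _ "{1..n}"])
qed

lemma antipode_in_boundary:
  assumes "x \<in> box_boundary n a b"
  shows "antipode n a b x \<in> box_boundary n a b"
proof -
  obtain i where i: "i \<in> {1..n}" "x \<in> int_box n a b" "x i = a i \<or> x i = b i"
    using assms by (auto simp: box_boundary_def)
  have "a j \<le> x j \<and> x j \<le> b j" if "j \<in> {1..n}" for j
    using i(2) that by (auto simp: int_box_def PiE_iff)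
  then have "antipode n a b x \<in> int_box n a b" by (force simp: int_box_def antipode_def)
  moreover have "antipode n a b x i = a i \<or> antipode n a b x i = b i"
    using i by (auto simp: antipode_def)
  ultimately show ?thesis using i(1) by (auto simp: box_boundary_def)
qed

lemma antipode_antipode:
  assumes "x \<in> box_boundary n a b"
  shows "antipode n a b (antipode n a b x) = x"
proof
  fix i
  have "x \<in> int_box n a b" using assms by (auto simp: box_boundary_def)
  then show "antipode n a b (antipode n a b x) i = x i"
    by (auto simp: antipode_def int_box_def PiE_iff extensional_def)
qed

theorem theorem5p7:
  fixes n :: nat and a b :: "nat \<Rightarrow> int" and f :: "point \<Rightarrow> point"
  assumes "n \<ge> 2"
    and "\<forall>i\<in>{1..n}. a i < b i"
    and "dig_continuous (box_boundary n a b) (c_adj n n) (int_lattice (n - 1)) (c_adj (n - 1) (n - 1)) f"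
  shows "\<exists>x\<in>box_boundary n a b.
           f x = f (antipode n a b x) \<or> c_adj (n - 1) (n - 1) (f x) (f (antipode n a b x))"
proof (rule ccontr)
  assume no_close: "\<not> ?thesis"
  define P where "P = box_boundary n a b"
  define \<sigma> where "\<sigma> = antipode n a b"
  define g where "g x i = f x i - f (\<sigma> x) i" for x i
  define cell where "cell t = {x \<in> P. \<forall>i\<in>{1..n}. \<bar>2 * x i - (a i + b i) - t i\<bar> \<le> 1}" for t :: point
  \<comment> \<open>\<open>pos t i\<close> permits the positive colour \<open>i\<close> at \<open>t\<close>. Since \<open>g\<close> is odd and \<open>- x\<close> runs through the
    cell of \<open>- t\<close>, the negative one is permitted by \<open>pos (- t) i\<close>. Colours count from \<open>0\<close> in \<open>L\<close> but
    coordinates from \<open>1\<close>.\<close>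
  define pos where "pos t i \<longleftrightarrow> (\<exists>x\<in>cell t. 2 \<le> g x i)" for t i
  define colour where "colour t = (LEAST i. i \<in> {1..n - 1} \<and> (pos t i \<or> pos (- t) i))" for t
  define L where "L t = 2 * (colour t - 1) + (if pos t (colour t) then 0 else 1)" for t
  define Bd where "Bd = {t. (\<forall>i\<in>{1..n}. \<bar>t i\<bar> \<le> b i - a i) \<and> (\<exists>i\<in>{1..n}. \<bar>t i\<bar> = b i - a i)}"

  have \<sigma>: "\<sigma> x \<in> P" "\<sigma> (\<sigma> x) = x" if "x \<in> P" for x
    using that antipode_in_boundary antipode_antipode by (auto simp: P_def \<sigma>_def)
  have lattice: "f x \<in> int_lattice (n - 1)" if "x \<in> P" for x
    using that assms(3) by (auto simp: dig_continuous_def P_def)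
  have P_lattice: "x \<in> int_lattice n" if "x \<in> P" for x
    using that by (auto simp: P_def box_boundary_def int_box_def int_lattice_def)
  have g_\<sigma>: "g (\<sigma> x) i = - g x i" if "x \<in> P" for x i using \<sigma>[OF that] by (simp add: g_def)
  have g_big: "\<exists>i\<in>{1..n - 1}. 2 \<le> \<bar>g x i\<bar>" if "x \<in> P" for x
  proof (rule ccontr)
    assume "\<not> ?thesis"
    then have "\<forall>i\<in>{1..n - 1}. \<bar>f x i - f (\<sigma> x) i\<bar> \<le> 1" by (force simp: g_def)
    then have "f x = f (\<sigma> x) \<or> c_adj (n - 1) (n - 1) (f x) (f (\<sigma> x))"
      using lattice that \<sigma>(1) by (auto simp: c_adj_full_iff)
    then show False using no_close that by (auto simp: P_def \<sigma>_def)
  qed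
  have f_step: "\<bar>f x i - f y i\<bar> \<le> 1"
    if "x \<in> P" "y \<in> P" "\<forall>j\<in>{1..n}. \<bar>x j - y j\<bar> \<le> 1" "i \<in> {1..n - 1}" for x y i
  proof (cases "x = y")
    case False
    then have "c_adj n n x y" using that P_lattice by (simp add: c_adj_full_iff)
    then have "c_adj (n - 1) (n - 1) (f x) (f y) \<or> f x = f y"
      using assms(3) that(1,2) unfolding dig_continuous_def P_def by blast
    then show ?thesis using that(4) by (auto simp: c_adj_full_iff)
  qed simp
  have \<sigma>_val: "\<sigma> x i = a i + b i - x i" if "i \<in> {1..n}" for x i
    using that by (simp add: \<sigma>_def antipode_def)
  have g_step: "\<bar>g x i - g y i\<bar> \<le> 2"
    if "x \<in> P" "y \<in> P" "\<forall>j\<in>{1..n}. \<bar>x j - y j\<bar> \<le> 1" "i \<in> {1..n - 1}" for x y i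
  proof -
    have "\<forall>j\<in>{1..n}. \<bar>\<sigma> x j - \<sigma> y j\<bar> \<le> 1" using that(3) by (force simp: \<sigma>_val)
    then have "\<bar>f (\<sigma> x) i - f (\<sigma> y) i\<bar> \<le> 1" using that \<sigma>(1) by (intro f_step) auto
    moreover have "\<bar>f x i - f y i\<bar> \<le> 1" using that by (rule f_step)
    ultimately show ?thesis unfolding g_def by linarith
  qed
  have cell_\<sigma>: "\<sigma> x \<in> cell (- t)" if "x \<in> cell t" for x t
    using that \<sigma>(1) unfolding cell_def by (force simp: \<sigma>_val)
  have neg_neg: "- (- t) = t" for t :: point by (simp add: fun_eq_iff)
  \<comment> \<open>If \<open>x\<close> and \<open>z\<close> are vertices of the cells of \<open>s\<close> and \<open>t\<close>, then \<open>2 x\<close> and \<open>2 z\<close> differ by at most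
    \<open>1 + 1 + 1\<close> in each coordinate, so \<open>x\<close> and \<open>z\<close> by at most \<open>1\<close>.\<close>
  have no_clash: False
    if pos: "pos s i" "pos (- t) i" and "i \<in> {1..n - 1}" "\<forall>j\<in>{1..n}. \<bar>s j - t j\<bar> \<le> 1" for s t i
  proof -
    obtain x where x: "x \<in> cell s" "2 \<le> g x i" using pos(1) by (auto simp: pos_def)
    obtain y where y: "y \<in> cell (- t)" "2 \<le> g y i" using pos(2) by (auto simp: pos_def)
    have P: "x \<in> P" "y \<in> P" using x(1) y(1) by (auto simp: cell_def)
    have \<sigma>y: "\<sigma> y \<in> cell t" using cell_\<sigma>[OF y(1)] by (simp add: neg_neg)
    have "\<bar>x j - \<sigma> y j\<bar> \<le> 1" if "j \<in> {1..n}" for j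
    proof -
      have "\<bar>2 * x j - (a j + b j) - s j\<bar> \<le> 1" "\<bar>2 * \<sigma> y j - (a j + b j) - t j\<bar> \<le> 1" "\<bar>s j - t j\<bar> \<le> 1"
        using x(1) \<sigma>y that \<open>\<forall>j\<in>{1..n}. \<bar>s j - t j\<bar> \<le> 1\<close> by (auto simp: cell_def)
      then show ?thesis by linarith
    qed
    then have "\<bar>g x i - g (\<sigma> y) i\<bar> \<le> 2" using P \<sigma>(1) \<open>i \<in> {1..n - 1}\<close> by (intro g_step) auto
    then show False using x(2) y(2) g_\<sigma>[OF P(2), of i] by linarith
  qed
  have cell_nonempty: "cell t \<noteq> {}" if t: "t \<in> Bd" for t
  proof -
    \<comment> \<open>The midpoint of the cell, rounded down; extreme coordinates are integral and stay extreme.\<close>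
    define x where "x = (\<lambda>i\<in>{1..n}. (t i + (a i + b i)) div 2)"
    obtain i where i: "i \<in> {1..n}" "\<bar>t i\<bar> = b i - a i" using t by (auto simp: Bd_def)
    have "a j \<le> x j \<and> x j \<le> b j" if "j \<in> {1..n}" for j
    proof -
      have "\<bar>t j\<bar> \<le> b j - a j" using t that by (auto simp: Bd_def)
      then have "2 * a j \<le> t j + (a j + b j)" "t j + (a j + b j) \<le> 2 * b j" by linarith+
      then show ?thesis using that by (simp add: x_def) linarith
    qed
    then have "x \<in> int_box n a b" by (auto simp: int_box_def x_def)
    moreover have "x i = a i \<or> x i = b i"
    proof -
      have "t i + (a i + b i) = 2 * a i \<or> t i + (a i + b i) = 2 * b i" using i(2) by linarith
      then show ?thesis using i(1) by (auto simp: x_def)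
    qed
    ultimately have "x \<in> P" using i(1) by (auto simp: P_def box_boundary_def)
    moreover have "\<bar>2 * x j - (a j + b j) - t j\<bar> \<le> 1" if "j \<in> {1..n}" for j
      using that by (simp add: x_def)
    ultimately have "x \<in> cell t" by (auto simp: cell_def)
    then show ?thesis by blast
  qed
  have colour: "colour t \<in> {1..n - 1}" "pos t (colour t) \<or> pos (- t) (colour t)" if t: "t \<in> Bd" for t
  proof -
    obtain x where x: "x \<in> cell t" using cell_nonempty[OF t] by blast
    then have xP: "x \<in> P" by (simp add: cell_def)
    then obtain i where i: "i \<in> {1..n - 1}" "2 \<le> \<bar>g x i\<bar>" using g_big by blast
    have "pos t i \<or> pos (- t) i"
    proof (cases "2 \<le> g x i")
      case True
      then show ?thesis using x by (auto simp: pos_def)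
    next
      case False
      then have "2 \<le> g (\<sigma> x) i" using i(2) g_\<sigma>[OF xP, of i] by linarith
      then show ?thesis using cell_\<sigma>[OF x] by (auto simp: pos_def)
    qed
    with i(1) have "i \<in> {1..n - 1} \<and> (pos t i \<or> pos (- t) i)" by blast
    from LeastI[of "\<lambda>i. i \<in> {1..n - 1} \<and> (pos t i \<or> pos (- t) i)", OF this]
    show "colour t \<in> {1..n - 1}" "pos t (colour t) \<or> pos (- t) (colour t)"
      unfolding colour_def by blast+
  qed
  have colour_neg: "colour (- t) = colour t" for t
    by (simp add: colour_def neg_neg disj_commute)
  have exclusive: "\<not> (pos t (colour t) \<and> pos (- t) (colour t))" if "t \<in> Bd" for t
    using no_clash[of t "colour t" t] colour(1)[OF that] by auto
  have "\<exists>x\<in>Bd. \<exists>y\<in>Bd. (\<forall>i\<in>{1..n}. \<bar>x i - y i\<bar> \<le> 1) \<and> L y = twin (L x)"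
    unfolding Bd_def
  proof (rule Tucker_sphere)
    show "1 \<le> n" using assms(1) by simp
    show "0 \<le> b i - a i" if "i \<in> {1..n}" for i using assms(2) that by force
  next
    fix t assume "t \<in> {t. (\<forall>i\<in>{1..n}. \<bar>t i\<bar> \<le> b i - a i) \<and> (\<exists>i\<in>{1..n}. \<bar>t i\<bar> = b i - a i)}"
    then have t: "t \<in> Bd" by (simp add: Bd_def)
    show "L (- t) = twin (L t)"
      using colour(2)[OF t] exclusive[OF t] by (auto simp: L_def colour_neg twin_def)
    show "L t div 2 < n - 1" using colour(1)[OF t] by (auto simp: L_def)
  qed
  then obtain s t where st: "s \<in> Bd" "t \<in> Bd" "\<forall>i\<in>{1..n}. \<bar>s i - t i\<bar> \<le> 1" "L t = twin (L s)"
    by blast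
  have "colour s - 1 = colour t - 1"
    using arg_cong[OF st(4), of "\<lambda>c. c div 2"] by (auto simp: L_def split: if_splits)
  then have same: "colour s = colour t" using colour(1)[OF st(1)] colour(1)[OF st(2)] by auto
  have "pos s (colour s) \<noteq> pos t (colour s)"
    using arg_cong[OF st(4), of even] by (auto simp: L_def same split: if_splits)
  moreover have "\<forall>i\<in>{1..n}. \<bar>t i - s i\<bar> \<le> 1" using st(3) by (simp add: abs_minus_commute)
  ultimately show False
    using colour[OF st(1)] colour[OF st(2)] no_clash[of s "colour s" t] no_clash[of t "colour s" s] st(3)
    by (auto simp: same)
qed

end
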